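(* Let $h>1$ be an integer, $q=2^h$, and let $U$ be a subset of $\mathrm{GF}(q)^{\star}$ with $|U|<\frac{q}{4}-1$. Let $\Omega$ be a regular hyperoval of $AG(2,q^2)$. Then $\Omega^{\star}=\Omega\cap\Phi$ is a complete arc in the projective closure $\overline{\mathcal M_U(q^2)}$, i.e. no three points of $\Omega^{\star}$ lie on a common line of $\overline{\mathcal M_U(q^2)}$, and no point of $\overline{\mathcal M_U(q^2)}$ outside $\Omega^{\star}$ can be added to $\Omega^{\star}$ so that the resulting set still has no three points on a common line of $\overline{\mathcal M_U(q^2)}$.
   Context: For a prime power $q$, the norm is $\|x\|=x^{q+1}$ for $x\in\mathrm{GF}(q^2)$, so $\|x\|\in\mathrm{GF}(q)$. For a proper subset $U$ of $\mathrm{GF}(q)^{\star}=\mathrm{GF}(q)\setminus\{0\}$, define on $\mathrm{GF}(q^2)$ the product $a\odot b=ab$ if $\|b\|\notin U$ and $a\odot b=a^q b$ if $\|b\|\in U$. The affine plane $\mathcal M_U(q^2)$ (the dual of an André plane) has as points the points $P(x,y)$, $x,y\in\mathrm{GF}(q^2)$, of $AG(2,q^2)$, and as lines the sets $[c]=\{P(x,y): x=c\}$ for $c\in\mathrm{GF}(q^2)$ and $[m,n]=\{P(x,y): y=m\odot x+n\}$ for $m,n\in\mathrm{GF}(q^2)$. Its projective closure $\overline{\mathcal M_U(q^2)}$ is obtained in the usual way by adding one point at infinity for each parallel class of lines (the lines $[m,n]$ with fixed $m$ form one class; the lines $[c]$ form another) and a line at infinity consisting of these points. Set $\Phi=\{P(x,y):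 \|x\|\notin U\}$ and $\Psi=\{P(x,y):\|x\|\in U\}$. For $q$ even, a regular hyperoval of $PG(2,q^2)$ is the union of a non-degenerate conic and its nucleus; a regular hyperoval of $AG(2,q^2)$ is a regular hyperoval of $PG(2,q^2)$ all of whose $q^2+2$ points are affine points. An arc is a set of points no three of which are collinear; it is complete if it is not contained in a strictly larger arc. *)

theory Defs
  imports Main
begin

text \<open>The field GF(q^2) is represented by a finite field type 'a with CARD('a) = q^2.
  GF(q) is the subfield {x. x^q = x}.\<close>

definition gf_sub :: "nat \<Rightarrow> 'a::field set" where
  "gf_sub q = {x. x ^ q = x}"

definition fnorm :: "nat \<Rightarrow> 'a::field \<Rightarrow> 'a" where
  "fnorm q x = x ^ (q + 1)"

definition odot :: "nat \<Rightarrow> 'a::field set \<Rightarrow> 'a \<Rightarrow> 'a \<Rightarrow> 'a" where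
  "odot q U a b = (if fnorm q b \<in> U then a ^ q * b else a * b)"

text \<open>Points of the projective closure: affine points, one point at infinity per
  slope m (class of the lines [m,n]), and one point at infinity for the vertical lines [c].\<close>
datatype 'a mpoint = Aff 'a 'a | InfS 'a | InfV

datatype 'a mline = Vert 'a | Sl 'a 'a | LInf

fun incid :: "nat \<Rightarrow> 'a::field set \<Rightarrow> 'a mpoint \<Rightarrow> 'a mline \<Rightarrow> bool" where
  "incid q U (Aff x y) (Vert c) = (x = c)"
| "incid q U (Aff x y) (Sl m n) = (y = odot q U m x + n)"
| "incid q U (Aff x y) LInf = False"
| "incid q U (InfS m') (Vert c) = False"
| "incid q U (InfS m') (Sl m n) = (m' = m)"
| "incid q U (InfS m') LInf = True"
| "incid q U InfV (Vert c) = True"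
| "incid q U InfV (Sl m n) = False"
| "incid q U InfV LInf = True"

definition is_arc :: "nat \<Rightarrow> 'a::field set \<Rightarrow> 'a mpoint set \<Rightarrow> bool" where
  "is_arc q U S = (\<forall>P\<in>S. \<forall>Q\<in>S. \<forall>R\<in>S. \<forall>l.
       P \<noteq> Q \<and> P \<noteq> R \<and> Q \<noteq> R \<and> incid q U P l \<and> incid q U Q l \<and> incid q U R l \<longrightarrow> False)"

definition is_complete_arc :: "nat \<Rightarrow> 'a::field set \<Rightarrow> 'a mpoint set \<Rightarrow> bool" where
  "is_complete_arc q U S = (is_arc q U S \<and> (\<forall>P. P \<notin> S \<longrightarrow> \<not> is_arc q U (insert P S)))"

definition qform :: "'a::field \<Rightarrow> 'a \<Rightarrow> 'a \<Rightarrow> 'a \<Rightarrow> 'a \<Rightarrow> 'a \<Rightarrow> 'a \<Rightarrow> 'a \<Rightarrow> 'a \<Rightarrow> 'a" where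
  "qform a b c f g h X Y Z = a*X^2 + b*Y^2 + c*Z^2 + f*Y*Z + g*X*Z + h*X*Y"

text \<open>Non-degeneracy of the conic Q = 0 (general discriminant 4abc + fgh - af^2 - bg^2 - ch^2,
  which in characteristic 2 reads af^2 + bg^2 + ch^2 + fgh).\<close>
definition conic_nondeg :: "'a::field \<Rightarrow> 'a \<Rightarrow> 'a \<Rightarrow> 'a \<Rightarrow> 'a \<Rightarrow> 'a \<Rightarrow> bool" where
  "conic_nondeg a b c f g h = (4*a*b*c + f*g*h - a*f^2 - b*g^2 - c*h^2 \<noteq> 0)"

text \<open>A regular hyperoval of AG(2,F), F of characteristic 2, given as a set of affine points
  (x,y) (i.e. projective points (x:y:1)): the union of a non-degenerate conic C and its nucleus N
  (a point not on C such that every line through N meets C in exactly one point), where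
  C has no point on the line at infinity Z = 0 and N is affine.  Since C has no points at
  infinity, the lines through the affine point N are the affine lines
  {(nx + t u, ny + t v)} with (u,v) \<noteq> (0,0).\<close>
definition regular_hyperoval_AG :: "('a::field \<times> 'a) set \<Rightarrow> bool" where
  "regular_hyperoval_AG \<Omega> = (\<exists>a b c f g h nx ny.
      conic_nondeg a b c f g h
    \<and> (\<forall>X Y. qform a b c f g h X Y 0 = 0 \<longrightarrow> X = 0 \<and> Y = 0)
    \<and> qform a b c f g h nx ny 1 \<noteq> 0
    \<and> (\<forall>u v. (u, v) \<noteq> (0, 0) \<longrightarrow> (\<exists>!t. qform a b c f g h (nx + t*u) (ny + t*v) 1 = 0))
    \<and> \<Omega> = {(x, y). qform a b c f g h x y 1 = 0} \<union> {(nx, ny)})"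

end

theory Submission
  imports Defs "HOL-Computational_Algebra.Polynomial"
begin

text \<open>
  On \<open>\<Phi>\<close> the lines of the plane are those of \<open>AG(2,q\<^sup>2)\<close>, so \<open>\<Omega>\<^sup>\<star>\<close> inherits the arc property.
  Every vertical line meets \<open>\<Omega>\<close> in at most two points, hence \<open>|\<Omega> \<inter> \<Psi>| \<le> 2|U|(q + 1)\<close>, which is less
  than half of \<open>|\<Omega>|\<close>.  Since \<open>\<Omega>\<close> has no tangents, the lines through a point at infinity or a point
  of \<open>\<Phi> - \<Omega>\<close> pair up the points of \<open>\<Omega>\<close>, and some pair lies in \<open>\<Phi>\<close>.

  For a point \<open>P\<close> of \<open>\<Psi>\<close>, normalised to \<open>P(1,0)\<close>, the lines through \<open>P\<close> meet \<open>\<Phi>\<close> in the lines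
  \<open>v = m u + m\<^sup>q\<close>, which belong to a dual Baer subplane with Baer involution
  \<open>\<tau>(u,v) = (u\<^sup>-\<^sup>q, v\<^sup>q u\<^sup>-\<^sup>q)\<close>.  If \<open>\<tau>\<close> preserves the conic, then a point \<open>p\<close> and \<open>\<tau>(p)\<close> lie on one
  such line, and \<open>p\<close> can be chosen with \<open>p\<close> and \<open>\<tau>(p)\<close> in \<open>\<Phi>\<close>.  Otherwise the conic and its
  conjugate have few common points, so \<open>\<Omega>\<close> has at most 9 points fixed by \<open>\<tau>\<close>.  If no line through \<open>P\<close>
  contained two points of \<open>\<Omega> \<inter> \<Phi>\<close>, each point of \<open>\<Omega> \<inter> \<Phi>\<close> would be joined by its line to a point
  of \<open>\<Omega> \<inter> \<Psi>\<close>; but a fixed point lies on at most \<open>q\<close> of the lines and any other point on at most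
  one, which is too few.
\<close>

section \<open>Finite fields of characteristic two and root counts\<close>

lemma power_card_UNIV_eq_same:
  fixes x :: "'a::{field,finite}"
  shows "x ^ card (UNIV :: 'a set) = x"
proof (cases "x = 0")
  case True
  then show ?thesis by (simp add: power_0_left card_gt_0_iff)
next
  case False
  define A where "A = (UNIV :: 'a set) - {0}"
  have "\<Prod>A = (\<Prod>y\<in>A. x * y)"
    by (rule prod.reindex_bij_witness[of _ "\<lambda>y. x * y" "\<lambda>y. y / x"])
       (use False in \<open>auto simp: A_def\<close>)
  also have "\<dots> = x ^ card A * \<Prod>A" by (simp add: prod.distrib)
  finally have "x ^ card A = 1" by (simp add: A_def)
  moreover have "card (UNIV :: 'a set) = Suc (card A)"
    unfolding A_def by (rule card.remove) auto
  ultimately show ?thesis by simp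
qed

lemma two_eq_zero_if_even_card:
  assumes "even (card (UNIV :: 'a::{field,finite} set))"
  shows "(2::'a) = 0"
proof -
  have "(- 1 :: 'a) = 1" using power_card_UNIV_eq_same[of "- 1 :: 'a"] assms by simp
  then show ?thesis by (metis add_neg_numeral_special(8) one_add_one)
qed

lemma add_self_char2:
  fixes x :: "'a::field"
  assumes "(2::'a) = 0"
  shows "x + x = 0"
  using assms by (metis mult_2 mult_zero_left)

lemma uminus_eq_char2:
  fixes x :: "'a::field"
  assumes "(2::'a) = 0"
  shows "- x = x"
  using add_self_char2[OF assms, of x] by (simp add: add_eq_0_iff)

lemma add_power_two_power_char2:
  fixes x y :: "'a::field"
  assumes "(2::'a) = 0"
  shows "(x + y) ^ (2 ^ k) = x ^ (2 ^ k) + y ^ (2 ^ k)"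
proof (induction k)
  case (Suc k)
  have "(x + y) ^ (2 ^ Suc k) = ((x + y) ^ (2 ^ k)) ^ 2"
    by (simp add: power_mult[symmetric] mult.commute)
  also have "\<dots> = (x ^ (2 ^ k)) ^ 2 + (y ^ (2 ^ k)) ^ 2"
    using assms by (simp add: Suc power2_sum)
  finally show ?case by (simp add: power_mult[symmetric] mult.commute)
qed simp

lemma card_fnorm_vimage_le:
  fixes V :: "'a::{field,finite} set"
  shows "card {x. fnorm q x \<in> V} \<le> (q + 1) * card V"
proof -
  have "card {x::'a. fnorm q x = w} \<le> q + 1" for w :: 'a
  proof -
    define p where "p = monom (1::'a) (q + 1) - [:w:]"
    have "coeff p (q + 1) = 1" by (simp add: p_def)
    then have "p \<noteq> 0" by auto
    moreover have "degree p \<le> q + 1"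
      unfolding p_def by (intro degree_diff_le) (auto simp: degree_monom_eq)
    moreover have "{x. fnorm q x = w} = {x. poly p x = 0}"
      by (auto simp: p_def fnorm_def poly_monom)
    ultimately show ?thesis using card_poly_roots_bound[of p] by simp
  qed
  then have "card (\<Union>w\<in>V. {x. fnorm q x = w}) \<le> (\<Sum>w\<in>V. q + 1)"
    by (intro order_trans[OF card_UN_le] sum_mono) auto
  moreover have "(\<Union>w\<in>V. {x. fnorm q x = w}) = {x. fnorm q x \<in> V}" by auto
  ultimately show ?thesis by (simp add: mult.commute)
qed

text \<open>Bounds the number of lines of the Baer family through a point; needed at the points
  fixed by the involution, where the slope is not determined.\<close>

lemma card_additive_roots_le:
  fixes u v :: "'a::{field,finite}"
  assumes "q > 1"
  shows "card {m. v = m * u + m ^ q} \<le> q"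
proof -
  define p where "p = monom 1 q + [:- v, u:]"
  have "coeff p q = 1 + coeff [:- v, u:] q" by (simp add: p_def)
  also have "coeff [:- v, u:] q = 0" by (rule coeff_eq_0) (use assms in auto)
  finally have "p \<noteq> 0" by auto
  moreover have "degree p \<le> q"
    unfolding p_def by (rule degree_add_le) (use assms in \<open>auto simp: degree_monom_eq\<close>)
  moreover have "{m. v = m * u + m ^ q} = {m. poly p m = 0}"
    by (auto simp: p_def poly_monom algebra_simps)
  ultimately show ?thesis using card_poly_roots_bound[of p] by simp
qed

section \<open>Quadratic forms along lines and secants of a regular hyperoval\<close>

lemma qform_along_line:
  "qform a b c f g h (x + t * u) (y + t * v) 1 =
     qform a b c f g h x y 1
     + t * (2 * a * x * u + 2 * b * y * v + f * v + g * u + h * (x * v + y * u))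
     + t\<^sup>2 * qform a b c f g h u v 0"
  by (simp add: qform_def algebra_simps power2_eq_square)

lemma quadratic_three_roots:
  fixes A B C :: "'a::field"
  assumes "A + r * B + r\<^sup>2 * C = 0" "A + s * B + s\<^sup>2 * C = 0" "A + t * B + t\<^sup>2 * C = 0"
    and "r \<noteq> s" "r \<noteq> t" "s \<noteq> t"
  shows "C = 0"
proof -
  have "(r - s) * (B + (r + s) * C) = 0" using assms(1,2) by algebra
  moreover have "(r - t) * (B + (r + t) * C) = 0" using assms(1,3) by algebra
  ultimately have "B + (r + s) * C = 0" "B + (r + t) * C = 0" using assms by auto
  then have "(s - t) * C = 0" by algebra
  then show ?thesis using assms by simp
qed

lemma regular_hyperoval_AGE:
  assumes "regular_hyperoval_AG \<Omega>"
  obtains a b c f g h nx ny where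
    "conic_nondeg a b c f g h"
    "\<And>X Y. qform a b c f g h X Y 0 = 0 \<Longrightarrow> X = 0 \<and> Y = 0"
    "qform a b c f g h nx ny 1 \<noteq> 0"
    "\<And>u v. (u, v) \<noteq> (0, 0) \<Longrightarrow> \<exists>!t. qform a b c f g h (nx + t*u) (ny + t*v) 1 = 0"
    "\<Omega> = {(x, y). qform a b c f g h x y 1 = 0} \<union> {(nx, ny)}"
  using assms unfolding regular_hyperoval_AG_def by (elim exE conjE) blast

text \<open>If the nucleus is one of the three points, the other two are conic points on one line
  through it. Otherwise the form restricted to the line has three roots, so its leading coefficient
  vanishes and the conic has a point at infinity.\<close>

lemma regular_hyperoval_AG_no_three_collinear:
  fixes \<Omega> :: "('a::field \<times> 'a) set"
  assumes "regular_hyperoval_AG \<Omega>" "(u, v) \<noteq> (0, 0)"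
    and "(x, y) \<in> \<Omega>" "(x + s * u, y + s * v) \<in> \<Omega>" "(x + t * u, y + t * v) \<in> \<Omega>"
    and "s \<noteq> 0" "t \<noteq> 0" "s \<noteq> t"
  shows False
proof -
  obtain a b c f g h nx ny where
    aniso: "\<And>X Y. qform a b c f g h X Y 0 = 0 \<Longrightarrow> X = 0 \<and> Y = 0"
    and tan: "\<And>u v. (u, v) \<noteq> (0, 0) \<Longrightarrow> \<exists>!t. qform a b c f g h (nx + t*u) (ny + t*v) 1 = 0"
    and \<Omega>: "\<Omega> = {(x, y). qform a b c f g h x y 1 = 0} \<union> {(nx, ny)}"
    by (rule regular_hyperoval_AGE[OF assms(1)]) blast
  let ?Q = "qform a b c f g h"
  have C: "?Q (x + r * u) (y + r * v) 1 = 0 \<or> nx = x + r * u \<and> ny = y + r * v" if "r \<in> {0, s, t}" for r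
    using that assms(3-5) \<Omega> by auto
  show False
  proof (cases "\<exists>r\<in>{0, s, t}. nx = x + r * u \<and> ny = y + r * v")
    case True
    then obtain r where r: "r \<in> {0, s, t}" "nx = x + r * u" "ny = y + r * v" by blast
    have on: "?Q (nx + (k - r) * u) (ny + (k - r) * v) 1 = 0" if "k \<in> {0, s, t}" "k \<noteq> r" for k
    proof -
      have "\<not> (nx = x + k * u \<and> ny = y + k * v)" using that assms(2) r by auto
      with C[OF that(1)] have "?Q (x + k * u) (y + k * v) 1 = 0" by blast
      then show ?thesis by (simp add: r algebra_simps)
    qed
    obtain k l where kl: "k \<in> {0, s, t}" "k \<noteq> r" "l \<in> {0, s, t}" "l \<noteq> r" "k \<noteq> l"
      using r(1) assms(6-8) by (elim insertE emptyE) blast+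
    from on[OF kl(1,2)] on[OF kl(3,4)] tan[OF assms(2)] have "k - r = l - r" by blast
    with kl show False by simp
  next
    case False
    then have "?Q (x + r * u) (y + r * v) 1 = 0" if "r \<in> {0, s, t}" for r using C that by blast
    from this[of 0] this[of s] this[of t] have "?Q u v 0 = 0"
      unfolding qform_along_line using quadratic_three_roots[of _ 0 _ _ s t] assms(6-8) by blast
    with aniso[of u v] assms(2) show False by auto
  qed
qed

text \<open>Through the nucleus this is the defining property. At a conic point only the vanishing
  of the linear term \<open>L u v\<close> prevents a second conic point, and then the line passes
  through the nucleus.\<close>

lemma regular_hyperoval_AG_no_tangent:
  fixes \<Omega> :: "('a::field \<times> 'a) set"
  assumes "regular_hyperoval_AG \<Omega>" "(u, v) \<noteq> (0, 0)" "(x, y) \<in> \<Omega>"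
  shows "\<exists>t. t \<noteq> 0 \<and> (x + t * u, y + t * v) \<in> \<Omega>"
proof -
  obtain a b c f g h nx ny where
    aniso: "\<And>X Y. qform a b c f g h X Y 0 = 0 \<Longrightarrow> X = 0 \<and> Y = 0"
    and n: "qform a b c f g h nx ny 1 \<noteq> 0"
    and tan: "\<And>u v. (u, v) \<noteq> (0, 0) \<Longrightarrow> \<exists>!t. qform a b c f g h (nx + t*u) (ny + t*v) 1 = 0"
    and \<Omega>: "\<Omega> = {(x, y). qform a b c f g h x y 1 = 0} \<union> {(nx, ny)}"
    by (rule regular_hyperoval_AGE[OF assms(1)]) blast
  let ?Q = "qform a b c f g h"
  define L where "L u v = 2 * a * x * u + 2 * b * y * v + f * v + g * u + h * (x * v + y * u)" for u v
  show ?thesis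
  proof (cases "(x, y) = (nx, ny)")
    case True
    from tan[OF assms(2)] obtain t where "?Q (nx + t * u) (ny + t * v) 1 = 0" by blast
    moreover from this n have "t \<noteq> 0" by auto
    ultimately show ?thesis using True \<Omega> by blast
  next
    case False
    then have xy: "?Q x y 1 = 0" using assms(3) \<Omega> by auto
    have Qline: "?Q (x + t * u) (y + t * v) 1 = t * (L u v + t * ?Q u v 0)" for t u v
      using qform_along_line[of a b c f g h x t u y v] xy
      by (simp add: L_def power2_eq_square algebra_simps)
    have Quv: "?Q u v 0 \<noteq> 0" if "(u, v) \<noteq> (0, 0)" for u v using aniso[of u v] that by auto
    show ?thesis
    proof (cases "L u v = 0")
      case False
      define t where "t = - L u v / ?Q u v 0"
      have "t \<noteq> 0" "L u v + t * ?Q u v 0 = 0" using False Quv[OF assms(2)] by (auto simp: t_def)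
      then show ?thesis using Qline \<Omega> by auto
    next
      case True
      define d e where "d = nx - x" and "e = ny - y"
      have de: "(d, e) \<noteq> (0, 0)" using \<open>(x, y) \<noteq> (nx, ny)\<close> by (auto simp: d_def e_def)
      have nxy: "nx = x + d" "ny = y + e" by (auto simp: d_def e_def)
      \<comment> \<open>Otherwise the line joining the nucleus to \<open>(x, y)\<close> meets the
        conic at two parameters counted from the nucleus, \<open>-1\<close> and
        \<open>t - 1\<close>.\<close>
      have Lde: "L d e = 0"
      proof (rule ccontr)
        assume "L d e \<noteq> 0"
        define t where "t = - L d e / ?Q d e 0"
        have t: "t \<noteq> 0" "L d e + t * ?Q d e 0 = 0" using \<open>L d e \<noteq> 0\<close> Quv[OF de] by (auto simp: t_def)
        then have "?Q (nx + (t - 1) * d) (ny + (t - 1) * e) 1 = 0"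
          using Qline[of t d e] by (simp add: nxy algebra_simps)
        moreover have "?Q (nx + (-1) * d) (ny + (-1) * e) 1 = 0" using xy by (simp add: nxy)
        ultimately have "t - 1 = -1" using tan[OF de] by blast
        with t show False by simp
      qed
      show ?thesis
      proof (cases "u * e = v * d")
        case dep: True
        define t where "t = (if u = 0 then e / v else d / u)"
        have "d = t * u" "e = t * v" using dep assms(2) by (auto simp: t_def field_simps)
        moreover from this de have "t \<noteq> 0" by auto
        ultimately show ?thesis using \<Omega> nxy by auto
      next
        case indep: False
        \<comment> \<open>Then the polar form at \<open>(x, y)\<close> vanishes identically, so \<open>(x, y)\<close> would be the only
          point of the conic.\<close>
        have L0: "L r s = 0" for r s
        proof -
          have "(u * e - v * d) * L r s = (r * e - s * d) * L u v + (u * s - v * r) * L d e"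
            by (simp add: L_def algebra_simps)
          then show ?thesis using True Lde indep by simp
        qed
        from tan[OF assms(2)] obtain t where t: "?Q (nx + t * u) (ny + t * v) 1 = 0" by blast
        define r s where "r = d + t * u" and "s = e + t * v"
        have "(r, s) \<noteq> (0, 0)"
        proof
          assume "(r, s) = (0, 0)"
          then have "d = - t * u" "e = - t * v" by (auto simp: r_def s_def eq_neg_iff_add_eq_0)
          with indep show False by simp
        qed
        moreover have "?Q r s 0 = 0" using t Qline[of 1 r s] L0 by (simp add: nxy r_def s_def add_ac)
        ultimately show ?thesis using Quv by blast
      qed
    qed
  qed
qed

text \<open>Each non-vertical line through the nucleus carries a further point; the nucleus itself
  makes the inequality strict.\<close>

lemma card_regular_hyperoval_AG_gt:
  fixes \<Omega> :: "('a::{field,finite} \<times> 'a) set"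
  assumes "regular_hyperoval_AG \<Omega>"
  shows "card (UNIV :: 'a set) < card \<Omega>"
proof -
  obtain nx ny where n: "(nx, ny) \<in> \<Omega>" by (rule regular_hyperoval_AGE[OF assms]) blast
  have "\<exists>t. t \<noteq> 0 \<and> (nx + t * 1, ny + t * k) \<in> \<Omega>" for k
    by (rule regular_hyperoval_AG_no_tangent[OF assms _ n]) simp
  then obtain t where t: "t k \<noteq> 0" "(nx + t k, ny + t k * k) \<in> \<Omega>" for k
    by (metis mult.right_neutral)
  define r where "r k = (nx + t k, ny + t k * k)" for k
  have "inj r" by (rule injI) (auto simp: r_def t)
  then have "card (UNIV :: 'a set) = card (range r)" by (simp add: card_image)
  also have "\<dots> < card \<Omega>"
  proof (rule psubset_card_mono)
    have "(nx, ny) \<notin> range r" using t by (auto simp: r_def)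
    then show "range r \<subset> \<Omega>" using t n by (auto simp: r_def)
  qed simp
  finally show ?thesis .
qed

lemma card_regular_hyperoval_AG_columns_le:
  fixes \<Omega> :: "('a::{field,finite} \<times> 'a) set"
  assumes "regular_hyperoval_AG \<Omega>"
  shows "card {(x, y) \<in> \<Omega>. x \<in> X} \<le> 2 * card X"
proof -
  have col: "card {p \<in> \<Omega>. fst p = x} \<le> 2" for x
  proof (rule ccontr)
    assume "\<not> card {p \<in> \<Omega>. fst p = x} \<le> 2"
    then have "3 \<le> card {p \<in> \<Omega>. fst p = x}" by simp
    then obtain T where T: "T \<subseteq> {p \<in> \<Omega>. fst p = x}" "card T = 3"
      by (meson obtain_subset_with_card_n)
    then obtain p1 p2 p3 where "T = {p1, p2, p3}" "p1 \<noteq> p2" "p2 \<noteq> p3" "p1 \<noteq> p3"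
      by (metis card_3_iff)
    with T obtain y1 y2 y3 where y: "(x, y1) \<in> \<Omega>" "(x, y2) \<in> \<Omega>" "(x, y3) \<in> \<Omega>"
      "y1 \<noteq> y2" "y2 \<noteq> y3" "y1 \<noteq> y3"
      by (cases p1; cases p2; cases p3) auto
    show False
      by (rule regular_hyperoval_AG_no_three_collinear[OF assms, of 0 1 x y1 "y2 - y1" "y3 - y1"])
         (use y in auto)
  qed
  have "{(x, y) \<in> \<Omega>. x \<in> X} = (\<Union>x\<in>X. {p \<in> \<Omega>. fst p = x})" by auto
  also have "card \<dots> \<le> (\<Sum>x\<in>X. 2)"
    by (intro order_trans[OF card_UN_le] sum_mono col) auto
  finally show ?thesis by (simp add: mult.commute)
qed

text \<open>The map carries \<open>(1, 0)\<close> to \<open>(k, e)\<close>, so this serves to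
  normalise a point of \<Psi>.\<close>

lemma regular_hyperoval_AG_affine_pullback:
  fixes \<Omega> :: "('a::field \<times> 'a) set"
  assumes "regular_hyperoval_AG \<Omega>" "k \<noteq> 0"
  shows "regular_hyperoval_AG {(x, y). (k * x, k * y + e) \<in> \<Omega>}"
proof -
  obtain a b c f g h nx ny where
    nd: "conic_nondeg a b c f g h"
    and aniso: "\<And>X Y. qform a b c f g h X Y 0 = 0 \<Longrightarrow> X = 0 \<and> Y = 0"
    and n: "qform a b c f g h nx ny 1 \<noteq> 0"
    and tan: "\<And>u v. (u, v) \<noteq> (0, 0) \<Longrightarrow> \<exists>!t. qform a b c f g h (nx + t*u) (ny + t*v) 1 = 0"
    and \<Omega>: "\<Omega> = {(x, y). qform a b c f g h x y 1 = 0} \<union> {(nx, ny)}"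
    by (rule regular_hyperoval_AGE[OF assms(1)]) blast
  let ?Q = "qform a b c f g h"
  define a' b' c' f' g' h' where
    "a' = a * k\<^sup>2" "b' = b * k\<^sup>2" "c' = c + b * e\<^sup>2 + f * e" "f' = k * (f + 2 * b * e)"
    "g' = k * (g + h * e)" "h' = h * k\<^sup>2"
  note d = this
  let ?Q' = "qform a' b' c' f' g' h'"
  have Q': "?Q' X Y 1 = ?Q (k * X) (k * Y + e) 1" for X Y
    by (simp add: d qform_def algebra_simps power2_eq_square)
  have Q'0: "?Q' X Y 0 = k\<^sup>2 * ?Q X Y 0" for X Y
    by (simp add: d qform_def algebra_simps power2_eq_square)
  have "4*a'*b'*c' + f'*g'*h' - a'*f'^2 - b'*g'^2 - c'*h'^2
      = k^4 * (4*a*b*c + f*g*h - a*f^2 - b*g^2 - c*h^2)"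
    unfolding d by algebra
  then have "conic_nondeg a' b' c' f' g' h'" using nd assms(2) by (simp add: conic_nondeg_def)
  moreover have "\<forall>X Y. ?Q' X Y 0 = 0 \<longrightarrow> X = 0 \<and> Y = 0"
    using assms(2) aniso by (metis Q'0 mult_eq_0_iff power_eq_0_iff)
  moreover have "?Q' (nx / k) ((ny - e) / k) 1 \<noteq> 0" using n assms(2) by (simp add: Q')
  moreover have "\<exists>!t. ?Q' (nx / k + t * u) ((ny - e) / k + t * v) 1 = 0" if "(u, v) \<noteq> (0, 0)" for u v
  proof -
    have "?Q' (nx / k + t * u) ((ny - e) / k + t * v) 1
        = ?Q (nx + t * (k * u)) (ny + t * (k * v)) 1" for t
      using assms(2) by (simp add: Q' distrib_left mult_ac)
    then show ?thesis using tan[of "k * u" "k * v"] that assms(2) by simp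
  qed
  moreover have "{(x, y). (k * x, k * y + e) \<in> \<Omega>}
      = {(x, y). ?Q' x y 1 = 0} \<union> {(nx / k, (ny - e) / k)}"
  proof -
    have "k * x = nx \<and> k * y + e = ny \<longleftrightarrow> x = nx / k \<and> y = (ny - e) / k" for x y
      using assms(2) by (simp add: nonzero_eq_divide_eq mult.commute eq_diff_eq)
    then show ?thesis by (simp add: \<Omega> Q' set_eq_iff)
  qed
  ultimately show ?thesis unfolding regular_hyperoval_AG_def by blast
qed

text \<open>Constant direction fields \<open>(u, v)\<close> give a parallel class, radial ones the
  lines through a point off \<Omega>. If no line held two points of \<open>\<Omega> - Y\<close>,
  passing to the second point would inject \<open>\<Omega> - Y\<close> into
  \<open>\<Omega> \<inter> Y\<close>.\<close>

lemma regular_hyperoval_AG_two_on_parallel_line: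
  fixes \<Omega> Y :: "('a::{field,finite} \<times> 'a) set"
  assumes hyp: "regular_hyperoval_AG \<Omega>"
    and dir: "\<And>x y. (x, y) \<in> \<Omega> \<Longrightarrow> (u x y, v x y) \<noteq> (0, 0)"
    and par: "\<And>x y t. (x, y) \<in> \<Omega> \<Longrightarrow> (x + t * u x y, y + t * v x y) \<in> \<Omega> \<Longrightarrow>
      \<exists>s. u (x + t * u x y) (y + t * v x y) = s * u x y \<and>
          v (x + t * u x y) (y + t * v x y) = s * v x y"
    and small: "2 * card (\<Omega> \<inter> Y) < card \<Omega>"
  shows "\<exists>x y t. t \<noteq> 0 \<and> (x, y) \<in> \<Omega> - Y \<and> (x + t * u x y, y + t * v x y) \<in> \<Omega> - Y"
proof (rule ccontr)
  assume no: "\<not> ?thesis"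
  have "\<exists>t. t \<noteq> 0 \<and> (x + t * u x y, y + t * v x y) \<in> \<Omega>" if "(x, y) \<in> \<Omega>" for x y
    using regular_hyperoval_AG_no_tangent[OF hyp dir[OF that] that] .
  then obtain t where t: "\<And>x y. (x, y) \<in> \<Omega> \<Longrightarrow> t x y \<noteq> 0"
    "\<And>x y. (x, y) \<in> \<Omega> \<Longrightarrow> (x + t x y * u x y, y + t x y * v x y) \<in> \<Omega>"
    by metis
  define r where "r = (\<lambda>(x, y). (x + t x y * u x y, y + t x y * v x y))"
  have "inj_on r (\<Omega> - Y)"
  proof (rule inj_onI, clarify)
    fix x1 y1 x2 y2
    assume p: "(x1, y1) \<in> \<Omega>" "(x2, y2) \<in> \<Omega>" and eq: "r (x1, y1) = r (x2, y2)"
    obtain X Z where XY: "r (x1, y1) = (X, Z)" by fastforce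
    \<comment> \<open>By \<open>par\<close>, every preimage of \<open>(X, Z)\<close> lies on the
      line through \<open>(X, Z)\<close> in its own direction, so two different ones would give
      three collinear points.\<close>
    have on_line: "\<exists>k. k \<noteq> 0 \<and> x = X + k * u X Z \<and> y = Z + k * v X Z"
      if xy: "(x, y) \<in> \<Omega>" and "r (x, y) = (X, Z)" for x y
    proof -
      have X: "X = x + t x y * u x y" "Z = y + t x y * v x y" using that by (auto simp: r_def)
      then obtain s where s: "u X Z = s * u x y" "v X Z = s * v x y"
        using par[OF xy t(2)[OF xy]] by auto
      have "(X, Z) \<in> \<Omega>" using t(2)[OF xy] X by simp
      from dir[OF this] s have "s \<noteq> 0" by auto
      then show ?thesis using t(1)[OF xy] s X by (intro exI[of _ "- t x y / s"]) auto
    qed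
    have "r (x2, y2) = (X, Z)" using eq XY by simp
    from on_line[OF p(1) XY] on_line[OF p(2) this] obtain k l where kl: "k \<noteq> 0" "l \<noteq> 0"
      "x1 = X + k * u X Z" "y1 = Z + k * v X Z" "x2 = X + l * u X Z" "y2 = Z + l * v X Z"
      by blast
    have "(X, Z) \<in> \<Omega>" using t(2)[OF p(1)] XY by (simp add: r_def)
    then have "k = l"
      using regular_hyperoval_AG_no_three_collinear[OF hyp dir, of X Z X Z k l] kl p by blast
    then show "x1 = x2 \<and> y1 = y2" using kl by simp
  qed
  moreover have "r ` (\<Omega> - Y) \<subseteq> \<Omega> \<inter> Y"
  proof (rule image_subsetI)
    fix p assume "p \<in> \<Omega> - Y"
    then obtain x y where p: "p = (x, y)" "(x, y) \<in> \<Omega> - Y" by (cases p) auto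
    then have "t x y \<noteq> 0" "r p \<in> \<Omega>" using t by (auto simp: r_def)
    moreover have "r p \<notin> \<Omega> - Y" using no p \<open>t x y \<noteq> 0\<close> by (auto simp: r_def)
    ultimately show "r p \<in> \<Omega> \<inter> Y" by blast
  qed
  ultimately have "card (\<Omega> - Y) \<le> card (\<Omega> \<inter> Y)"
    by (metis card_inj_on_le finite)
  moreover have "card \<Omega> = card (\<Omega> - Y) + card (\<Omega> \<inter> Y)"
    by (metis add.commute card_Int_Diff finite)
  ultimately show False using small by simp
qed

section \<open>Intersection of a conic with its conjugate\<close>

text \<open>The second equation is linear in \<open>v\<close>, so elimination leaves a polynomial in
  \<open>u\<close> of degree at most 4. It is nonzero because the conic has no points at
  infinity.\<close>

lemma card_conic_intersection_abscissae_le: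
  fixes a b c f g h :: "'a::{field,finite}"
  assumes aniso: "\<And>X Y. qform a b c f g h X Y 0 = 0 \<Longrightarrow> X = 0 \<and> Y = 0"
    and "\<not> (A = 0 \<and> C = 0 \<and> F = 0 \<and> G = 0 \<and> H = 0)"
  shows "card {u. \<exists>v. qform a b c f g h u v 1 = 0 \<and> A * u\<^sup>2 + C + F * v + G * u + H * u * v = 0} \<le> 4"
proof -
  \<comment> \<open>The resultant, eliminating \<open>v\<close>.\<close>
  define R where "R = [:b * C\<^sup>2 - f * C * F + c * F\<^sup>2,
    2 * b * C * G - f * (C * H + G * F) - h * C * F + g * F\<^sup>2 + 2 * c * F * H,
    b * (G\<^sup>2 + 2 * A * C) - f * (A * F + G * H) - h * (C * H + G * F) + a * F\<^sup>2
      + 2 * g * F * H + c * H\<^sup>2,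
    2 * b * A * G - f * A * H - h * (A * F + G * H) + 2 * a * F * H + g * H\<^sup>2,
    b * A\<^sup>2 - h * A * H + a * H\<^sup>2:]"
  have "R \<noteq> 0"
  proof
    assume "R = 0"
    then have r: "b * C\<^sup>2 - f * C * F + c * F\<^sup>2 = 0"
      "b * (G\<^sup>2 + 2 * A * C) - f * (A * F + G * H) - h * (C * H + G * F) + a * F\<^sup>2
        + 2 * g * F * H + c * H\<^sup>2 = 0"
      "b * A\<^sup>2 - h * A * H + a * H\<^sup>2 = 0"
      by (auto simp: R_def)
    \<comment> \<open>The leading coefficient of \<open>R\<close> is the form at
      \<open>(H, - A, 0)\<close>; once \<open>H\<close> and \<open>A\<close> vanish, the quadratic
      coefficient is the form at \<open>(F, - G, 0)\<close>.\<close>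
    have HA: "H = 0" "A = 0"
      using aniso[of H "- A"] r(3) by (auto simp: qform_def algebra_simps)
    have FG: "F = 0" "G = 0"
      using aniso[of F "- G"] r(2) HA by (auto simp: qform_def algebra_simps)
    have "b \<noteq> 0" using aniso[of 0 1] by (auto simp: qform_def)
    then have "C = 0" using r(1) FG by simp
    with HA FG assms(2) show False by simp
  qed
  moreover have "degree R \<le> 4" by (auto simp: R_def degree_pCons_eq_if)
  moreover have "poly R u = 0"
    if "qform a b c f g h u v 1 = 0" "A * u\<^sup>2 + C + F * v + G * u + H * u * v = 0" for u v
  proof -
    \<comment> \<open>The second equation reads \<open>W + v * S = 0\<close>; nothing is divided by
      \<open>S\<close>, which may be zero.\<close>
    define W S where "W = A * u\<^sup>2 + G * u + C" and "S = F + H * u"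
    have W: "W = - v * S" using that(2) by (simp add: W_def S_def algebra_simps eq_neg_iff_add_eq_0)
    have "poly R u = b * W\<^sup>2 - (f + h * u) * W * S + (a * u\<^sup>2 + g * u + c) * S\<^sup>2"
      by (simp add: R_def W_def S_def power2_eq_square algebra_simps)
    also have "\<dots> = S\<^sup>2 * qform a b c f g h u v 1"
      by (simp add: W qform_def power2_eq_square algebra_simps)
    finally show ?thesis using that by simp
  qed
  then have "{u. \<exists>v. qform a b c f g h u v 1 = 0 \<and> A * u\<^sup>2 + C + F * v + G * u + H * u * v = 0}
      \<subseteq> {u. poly R u = 0}" by blast
  then have "card {u. \<exists>v. qform a b c f g h u v 1 = 0 \<and> A * u\<^sup>2 + C + F * v + G * u + H * u * v = 0}
      \<le> card {u. poly R u = 0}" by (intro card_mono) auto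
  ultimately show ?thesis using card_poly_roots_bound[of R] by linarith
qed

section \<open>Lines through \<open>P(1,0)\<close> and the dual Baer subplane\<close>

context
  fixes q :: nat
  assumes two: "(2::'a::{field,finite}) = 0"
    and frob_add: "\<And>x y :: 'a. (x + y) ^ q = x ^ q + y ^ q"
    and frob_frob: "\<And>x :: 'a. (x ^ q) ^ q = x"
begin

lemma fnorm_power_q: "fnorm q x ^ q = fnorm q (x::'a)"
  by (simp add: fnorm_def power_mult_distrib frob_frob mult.commute)

text \<open>Eliminate \<open>m ^ q\<close> from the equation and its conjugate; its two occurrences
  cancel in characteristic two.\<close>

lemma baer_line_slope_unique:
  fixes u v m :: 'a
  assumes "v = m * u + m ^ q" "fnorm q u \<noteq> 1"
  shows "m = (u ^ q * v + v ^ q) / (fnorm q u + 1)"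
proof -
  have "fnorm q u + 1 \<noteq> 0"
    using assms(2) uminus_eq_char2[OF two, of 1] by (metis eq_neg_iff_add_eq_0)
  moreover have "v ^ q = m ^ q * u ^ q + m"
    by (simp add: assms(1) frob_add power_mult_distrib frob_frob)
  then have "u ^ q * v + v ^ q = m * (fnorm q u + 1) + (m ^ q * u ^ q + m ^ q * u ^ q)"
    by (simp add: assms(1) fnorm_def algebra_simps)
  ultimately show ?thesis by (simp add: add_self_char2[OF two])
qed

text \<open>The only candidate left by the elimination works, because its denominator is fixed by
  \<open>x \<mapsto> x ^ q\<close>.\<close>

lemma baer_line_slope_exists:
  fixes u v :: 'a
  assumes "fnorm q u \<noteq> 1"
  shows "\<exists>m. v = m * u + m ^ q"
proof
  define w where "w = fnorm q u + 1"
  have w: "w \<noteq> 0"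
    using assms uminus_eq_char2[OF two, of 1] unfolding w_def by (metis eq_neg_iff_add_eq_0)
  have wq: "w ^ q = w" by (simp add: w_def frob_add fnorm_power_q)
  let ?m = "(u ^ q * v + v ^ q) / w"
  have "?m ^ q = (u * v ^ q + v) / w"
    by (simp add: power_divide wq frob_add power_mult_distrib frob_frob)
  then have "?m * u + ?m ^ q = (v * w + (u * v ^ q + u * v ^ q)) / w"
    by (simp add: add_divide_distrib[symmetric]) (simp add: w_def fnorm_def algebra_simps)
  then show "v = ?m * u + ?m ^ q" using w by (simp add: add_self_char2[OF two])
qed

text \<open>The lines \<open>v = m * u + m ^ q\<close> form, together with the verticals over norm-one abscissae, a dual
  Baer subplane.  The points fixed by its Baer involution \<open>(u, v) \<mapsto> (1 / u ^ q, v ^ q / u ^ q)\<close> are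
  those with \<open>fnorm q u = 1\<close> and \<open>u * v ^ q = v\<close>; every other affine point with \<open>u \<noteq> 0\<close> is on
  exactly one of the lines, namely the one joining it to its image.\<close>

lemma two_on_baer_line:
  fixes \<Omega> :: "('a \<times> 'a) set" and U :: "'a set"
  assumes hyp: "regular_hyperoval_AG \<Omega>"
    and card: "card (UNIV :: 'a set) = q\<^sup>2"
    and U: "1 \<in> U" "0 \<notin> U" and small: "4 * (card U + 2) \<le> q"
  shows "\<exists>x y x' y' m. (x, y) \<in> \<Omega> \<and> (x', y') \<in> \<Omega> \<and> (x, y) \<noteq> (x', y') \<and>
    fnorm q x \<notin> U \<and> fnorm q x' \<notin> U \<and> y = m * x + m ^ q \<and> y' = m * x' + m ^ q"
proof -
  obtain a b c f g h nx ny where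
    aniso: "\<And>X Y. qform a b c f g h X Y 0 = 0 \<Longrightarrow> X = 0 \<and> Y = 0"
    and \<Omega>: "\<Omega> = {(x, y). qform a b c f g h x y 1 = 0} \<union> {(nx, ny)}"
    by (rule regular_hyperoval_AGE[OF hyp]) blast
  let ?Q = "qform a b c f g h"
  have big: "q\<^sup>2 < card \<Omega>"
    using card_regular_hyperoval_AG_gt[OF hyp] card by simp
  have q: "q > 1" using small by simp
  have b: "b \<noteq> 0" using aniso[of 0 1] by (auto simp: qform_def)
  have columns: "card {(x, y) \<in> \<Omega>. fnorm q x \<in> V} \<le> 2 * ((q + 1) * card V)" for V
  proof -
    have "card {(x, y) \<in> \<Omega>. x \<in> {x. fnorm q x \<in> V}} \<le> 2 * card {x. fnorm q x \<in> V}"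
      by (rule card_regular_hyperoval_AG_columns_le[OF hyp])
    also have "\<dots> \<le> 2 * ((q + 1) * card V)" using card_fnorm_vimage_le[of q V] by simp
    finally show ?thesis by simp
  qed
  \<comment> \<open>Coefficients of \<open>b ^ q\<close> times the form plus \<open>b\<close> times
    its conjugate under \<tau>, which exchanges the roles of \<open>a\<close> and \<open>c\<close>
    and of \<open>f\<close> and \<open>h\<close>. The terms in \<open>y\<^sup>2\<close> cancel; if
    the rest vanishes, the two forms are proportional.\<close>
  define A C F G H where
    "A = b ^ q * a + b * c ^ q" "C = b ^ q * c + b * a ^ q" "F = b ^ q * f + b * h ^ q"
    "G = b ^ q * g + b * g ^ q" "H = b ^ q * h + b * f ^ q"
  note D = this
  show ?thesis
  proof (cases "A = 0 \<and> C = 0 \<and> F = 0 \<and> G = 0 \<and> H = 0")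
    case True
    have eqs: "b ^ q * a = b * c ^ q" "b ^ q * c = b * a ^ q" "b ^ q * f = b * h ^ q"
      "b ^ q * g = b * g ^ q" "b ^ q * h = b * f ^ q"
      using True unfolding D by (simp_all add: add_eq_0_iff uminus_eq_char2[OF two])
    \<comment> \<open>Norms to avoid: \<tau> inverts the norm, which explains the inverses, and is
      undefined at abscissa 0.\<close>
    define V where "V = U \<union> inverse ` U \<union> {0}"
    have "card V \<le> card U + card (inverse ` U) + 1"
      unfolding V_def by (intro order_trans[OF card_Un_le] add_mono) auto
    also have "card (inverse ` U) \<le> card U" by (rule card_image_le) simp
    finally have V: "card V \<le> 2 * card U + 1" by simp
    \<comment> \<open>Invariance under \<tau> is used for conic points only, so the nucleus is
      discarded; it is the extra 1 in the count.\<close>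
    have "\<exists>x y. ?Q x y 1 = 0 \<and> fnorm q x \<notin> V"
    proof (rule ccontr)
      assume "\<not> ?thesis"
      then have "\<Omega> \<subseteq> {(x, y) \<in> \<Omega>. fnorm q x \<in> V} \<union> {(nx, ny)}" using \<Omega> by auto
      then have "card \<Omega> \<le> card ({(x, y) \<in> \<Omega>. fnorm q x \<in> V} \<union> {(nx, ny)})"
        by (intro card_mono) auto
      also have "\<dots> \<le> 2 * ((q + 1) * card V) + 1"
        by (intro order_trans[OF card_Un_le] add_mono columns) auto
      also have "\<dots> \<le> (q + 1) * (4 * card U + 2) + 1"
        using mult_le_mono2[OF V, of "2 * (q + 1)"] by simp
      also have "\<dots> \<le> (q + 1) * (q - 6) + 1"
        using small by (intro add_mono mult_le_mono2) auto
      also have "\<dots> \<le> q\<^sup>2"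
      proof -
        obtain k where "q = 6 + k" using small le_Suc_ex[of 6 q] by auto
        then show ?thesis by (simp add: power2_eq_square algebra_simps)
      qed
      finally show False using big by simp
    qed
    then obtain x y where xy: "?Q x y 1 = 0" "fnorm q x \<notin> V" by blast
    have x0: "x \<noteq> 0" using xy(2) by (auto simp: V_def fnorm_def)
    have x1: "fnorm q x \<noteq> 1" using xy(2) U by (auto simp: V_def)
    define x' y' where "x' = 1 / x ^ q" and "y' = y ^ q / x ^ q"
    have "b ^ q * ((x ^ q)\<^sup>2 * ?Q x' y' 1)
      = b ^ q * a + b ^ q * b * (y ^ q)\<^sup>2 + b ^ q * c * (x ^ q)\<^sup>2 + b ^ q * f * y ^ q * x ^ q
        + b ^ q * g * x ^ q + b ^ q * h * y ^ q"
      using x0 by (simp add: qform_def x'_def y'_def power2_eq_square divide_simps) (simp add: algebra_simps)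
    also have "\<dots> = b * (?Q x y 1) ^ q"
      unfolding eqs
      by (simp add: qform_def frob_add power_mult_distrib power2_eq_square algebra_simps)
    also have "\<dots> = 0" using xy(1) q by (simp add: power_0_left)
    finally have Q': "?Q x' y' 1 = 0" using b x0 by simp
    have "fnorm q x' = inverse (fnorm q x)"
      using fnorm_power_q[of x]
      by (simp add: x'_def fnorm_def power_mult_distrib power_divide frob_frob field_simps)
    then have x'U: "fnorm q x' \<notin> U" using xy(2) by (force simp: V_def)
    have "x' \<noteq> x" using x1 x0 by (auto simp: x'_def fnorm_def field_simps)
    obtain m where m: "y = m * x + m ^ q" using baer_line_slope_exists[OF x1] by blast
    have "y' = m * x' + m ^ q"
      using x0 by (simp add: y'_def x'_def m frob_add power_mult_distrib frob_frob field_simps)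
    then show ?thesis using m Q' xy x'U \<open>x' \<noteq> x\<close> \<Omega>
      by (intro exI[of _ x] exI[of _ y] exI[of _ x'] exI[of _ y'] exI[of _ m]) (auto simp: V_def)
  next
    case False
    define B where "B = {(x, y) \<in> \<Omega>. fnorm q x = 1 \<and> x * y ^ q = y}"
    define X where "X = {x. \<exists>y. ?Q x y 1 = 0 \<and> A * x\<^sup>2 + C + F * y + G * x + H * x * y = 0}"
    have X: "card X \<le> 4" unfolding X_def by (rule card_conic_intersection_abscissae_le[OF aniso False])
    \<comment> \<open>A fixed conic point also satisfies the conjugate equation, hence the
      combination without \<open>y\<^sup>2\<close>. Four abscissae with two points each, plus the
      nucleus, give the bound 9.\<close>
    have "B \<subseteq> {(x, y) \<in> \<Omega>. x \<in> X} \<union> {(nx, ny)}"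
    proof (rule subrelI)
      fix x y assume xy: "(x, y) \<in> B"
      show "(x, y) \<in> {(x, y) \<in> \<Omega>. x \<in> X} \<union> {(nx, ny)}"
      proof (cases "(x, y) = (nx, ny)")
        case False
        then have Q: "?Q x y 1 = 0" and xn: "x ^ q * x = 1" and yx: "x * y ^ q = y" and xy\<Omega>: "(x, y) \<in> \<Omega>"
          using xy by (auto simp: B_def \<Omega> fnorm_def mult.commute)
        have "0 = x\<^sup>2 * (?Q x y 1) ^ q" using Q q by (simp add: power_0_left)
        also have "\<dots> = a ^ q * (x ^ q * x)\<^sup>2 + b ^ q * (x * y ^ q)\<^sup>2 + c ^ q * x\<^sup>2
            + f ^ q * (x * y ^ q) * x + g ^ q * (x ^ q * x) * x + h ^ q * (x ^ q * x) * (x * y ^ q)"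
          by (simp add: qform_def frob_add power_mult_distrib power2_eq_square algebra_simps)
        also have "\<dots> = a ^ q + b ^ q * y\<^sup>2 + c ^ q * x\<^sup>2 + f ^ q * y * x + g ^ q * x + h ^ q * y"
          unfolding xn yx by simp
        finally have conj: "a ^ q + b ^ q * y\<^sup>2 + c ^ q * x\<^sup>2 + f ^ q * y * x + g ^ q * x + h ^ q * y = 0"
          by simp
        have "A * x\<^sup>2 + C + F * y + G * x + H * x * y = b ^ q * ?Q x y 1
            + b * (a ^ q + b ^ q * y\<^sup>2 + c ^ q * x\<^sup>2 + f ^ q * y * x + g ^ q * x + h ^ q * y)
            - 2 * (b * b ^ q * y\<^sup>2)"
          unfolding D by (simp add: qform_def algebra_simps)
        also have "\<dots> = 0" unfolding Q conj two by simp
        finally show ?thesis using Q xy\<Omega> by (auto simp: X_def)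
      qed simp
    qed
    then have "card B \<le> card ({(x, y) \<in> \<Omega>. x \<in> X} \<union> {(nx, ny)})" by (intro card_mono) auto
    also have "\<dots> \<le> 2 * card X + 1"
      by (intro order_trans[OF card_Un_le] add_mono card_regular_hyperoval_AG_columns_le[OF hyp]) auto
    finally have card_B: "card B \<le> 9" using X by simp
    show ?thesis
    proof (rule ccontr)
      assume no: "\<not> ?thesis"
      define \<Omega>\<Phi> where "\<Omega>\<Phi> = {(x, y) \<in> \<Omega>. fnorm q x \<notin> U}"
      \<comment> \<open>Norm one is left out: there a point does not determine a slope, and the
        fixed points are counted through \<open>B\<close>.\<close>
      define \<Omega>\<Psi> where "\<Omega>\<Psi> = {(x, y) \<in> \<Omega>. fnorm q x \<in> U - {1}}"
      define slope where "slope = (\<lambda>(x, y). SOME m::'a. y = m * x + m ^ q)"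
      have slope: "y = slope (x, y) * x + slope (x, y) ^ q" if "fnorm q x \<noteq> 1" for x y
        using someI_ex[OF baer_line_slope_exists[OF that, of y]] by (simp add: slope_def)
      have slope_eq: "slope (x, y) = m" if "fnorm q x \<noteq> 1" "y = m * x + m ^ q" for x y m
        using baer_line_slope_unique[OF that(2,1)] baer_line_slope_unique[OF slope that(1), OF that(1)] by metis
      have not_U: "fnorm q x \<noteq> 1" if "fnorm q x \<notin> U" for x using that U by auto
      have "inj_on slope \<Omega>\<Phi>"
      proof (rule inj_onI)
        fix p p' assume p: "p \<in> \<Omega>\<Phi>" "p' \<in> \<Omega>\<Phi>" and eq: "slope p = slope p'"
        obtain x y x' y' where xy: "p = (x, y)" "p' = (x', y')" by fastforce
        from p have "(x, y) \<in> \<Omega>" "(x', y') \<in> \<Omega>" and n: "fnorm q x \<notin> U" "fnorm q x' \<notin> U"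
          by (auto simp: \<Omega>\<Phi>_def xy)
        with no slope[OF not_U[OF n(1)], of y] slope[OF not_U[OF n(2)], of y'] eq
        have "(x, y) = (x', y')" unfolding xy by metis
        then show "p = p'" by (simp add: xy)
      qed
      then have "card \<Omega>\<Phi> = card (slope ` \<Omega>\<Phi>)" by (simp add: card_image)
      also have "slope ` \<Omega>\<Phi> \<subseteq> slope ` \<Omega>\<Psi> \<union> (\<Union>(x, y)\<in>B. {m. y = m * x + m ^ q})"
      proof (rule image_subsetI)
        fix p assume "p \<in> \<Omega>\<Phi>"
        then obtain x y where p: "p = (x, y)" "(x, y) \<in> \<Omega>" "fnorm q x \<notin> U"
          by (auto simp: \<Omega>\<Phi>_def)
        define m where "m = slope p"
        have m: "y = m * x + m ^ q" unfolding m_def p(1) by (rule slope[OF not_U[OF p(3)]])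
        obtain t where t: "t \<noteq> 0" "(x + t * 1, y + t * m) \<in> \<Omega>"
          using regular_hyperoval_AG_no_tangent[OF hyp _ p(2), of 1 m] by auto
        define x' y' where "x' = x + t" and "y' = y + t * m"
        have xy': "(x', y') \<in> \<Omega>" "(x, y) \<noteq> (x', y')" using t by (auto simp: x'_def y'_def)
        have m': "y' = m * x' + m ^ q" using m by (simp add: x'_def y'_def algebra_simps)
        have x'U: "fnorm q x' \<in> U" using no p xy' m m' by metis
        show "slope p \<in> slope ` \<Omega>\<Psi> \<union> (\<Union>(x, y)\<in>B. {m. y = m * x + m ^ q})"
        proof (cases "fnorm q x' = 1")
          case True
          \<comment> \<open>Over norm one, a point on a line of the family is necessarily fixed by
            \<tau>.\<close>
          have "x' * y' ^ q = m ^ q * fnorm q x' + m * x'"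
            by (simp add: m' frob_add power_mult_distrib frob_frob fnorm_def algebra_simps)
          then have "(x', y') \<in> B" using True m' xy' by (simp add: B_def add.commute)
          then show ?thesis using m' unfolding m_def[symmetric] by blast
        next
          case False
          then have "(x', y') \<in> \<Omega>\<Psi>" using x'U xy' by (simp add: \<Omega>\<Psi>_def)
          moreover have "slope (x', y') = m" using False m' by (rule slope_eq)
          ultimately show ?thesis unfolding m_def[symmetric] by force
        qed
      qed
      then have "card (slope ` \<Omega>\<Phi>) \<le> card (slope ` \<Omega>\<Psi> \<union> (\<Union>(x, y)\<in>B. {m. y = m * x + m ^ q}))"
        by (intro card_mono) auto
      also have "\<dots> \<le> card (slope ` \<Omega>\<Psi>) + card (\<Union>(x, y)\<in>B. {m. y = m * x + m ^ q})"
        by (rule card_Un_le)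
      also have "card (slope ` \<Omega>\<Psi>) \<le> card \<Omega>\<Psi>" by (rule card_image_le) simp
      also have "card \<Omega>\<Psi> \<le> 2 * ((q + 1) * (card U - 1))"
        using columns[of "U - {1}"] U by (simp add: \<Omega>\<Psi>_def)
      also have "card (\<Union>(x, y)\<in>B. {m. y = m * x + m ^ q}) \<le> (\<Sum>(x, y)\<in>B. q)"
        by (intro order_trans[OF card_UN_le] sum_mono) (auto intro: card_additive_roots_le[OF q])
      also have "(\<Sum>(x, y)\<in>B. q) \<le> 9 * q" using card_B by simp
      finally have "card \<Omega>\<Phi> \<le> 2 * ((q + 1) * (card U - 1)) + 9 * q" by simp
      moreover have "card \<Omega> \<le> card \<Omega>\<Phi> + 2 * ((q + 1) * card U)"
      proof -
        have "card \<Omega> = card (\<Omega>\<Phi> \<union> {(x, y) \<in> \<Omega>. fnorm q x \<in> U})"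
          by (rule arg_cong[of _ _ card]) (auto simp: \<Omega>\<Phi>_def)
        also have "\<dots> \<le> card \<Omega>\<Phi> + card {(x, y) \<in> \<Omega>. fnorm q x \<in> U}" by (rule card_Un_le)
        finally show ?thesis using columns[of U] by linarith
      qed
      \<comment> \<open>With \<open>card U = k + 1\<close> and \<open>q >= 4 * k + 12\<close>, the
        two bounds give \<open>card \<Omega> <= (q + 1) * (4 * k + 2) + 9 * q\<close>, which is at
        most \<open>q^2 - 10\<close>.\<close>
      moreover have "card U \<ge> 1" using U by (metis One_nat_def Suc_leI card_gt_0_iff empty_iff finite)
      then obtain k where "card U = k + 1" by (metis add.commute le_Suc_ex)
      moreover obtain l where "q = 4 * (card U + 2) + l" using small le_Suc_ex by blast
      ultimately show False using big by (simp add: power2_eq_square algebra_simps)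
    qed
  qed
qed

end

section \<open>Arc property and completeness in the closure of the dual Andre plane\<close>

theorem theorem1p1:
  fixes h :: nat and q :: nat
    and U :: "'a::{field,finite} set"
    and \<Omega> :: "('a \<times> 'a) set"
  assumes "h > 1"
    and "q = 2 ^ h"
    and "card (UNIV :: 'a set) = q ^ 2"
    and "U \<subseteq> gf_sub q - {0}"
    and "4 * (card U + 1) < q"
    and "regular_hyperoval_AG \<Omega>"
  shows "is_complete_arc q U {Aff x y | x y. (x, y) \<in> \<Omega> \<and> fnorm q x \<notin> U}"
proof -
  note hyp = assms(6)
  let ?S = "{Aff x y | x y. (x, y) \<in> \<Omega> \<and> fnorm q x \<notin> U}"
  let ?Y = "{(x, y). fnorm q x \<in> U}"
  have two: "(2::'a) = 0" using assms(1-3) by (intro two_eq_zero_if_even_card) simp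
  have frob_add: "(x + y) ^ q = x ^ q + y ^ q" for x y :: 'a
    unfolding assms(2) by (rule add_power_two_power_char2[OF two])
  have frob_frob: "(x ^ q) ^ q = x" for x :: 'a
    using power_card_UNIV_eq_same[of x] assms(3) by (simp add: power_mult[symmetric] power2_eq_square)
  \<comment> \<open>Since \<open>h > 1\<close>, 4 divides \<open>q\<close>, so the strict bound
    improves by a whole unit in \<open>card U\<close>.\<close>
  have small: "4 * (card U + 2) \<le> q"
  proof -
    obtain k where "h = 2 + k" using assms(1) le_Suc_ex[of 2 h] by auto
    then have q: "q = 4 * 2 ^ k" using assms(2) by (simp add: power_add)
    then have "card U + 1 < 2 ^ k" using assms(5) by simp
    then show ?thesis unfolding q by simp
  qed
  have few: "2 * card (\<Omega> \<inter> ?Y) < card \<Omega>"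
  proof -
    have "card (\<Omega> \<inter> ?Y) = card {(x, y) \<in> \<Omega>. x \<in> {x. fnorm q x \<in> U}}"
      by (rule arg_cong[of _ _ card]) auto
    also have "\<dots> \<le> 2 * card {x. fnorm q x \<in> U}"
      by (rule card_regular_hyperoval_AG_columns_le[OF hyp])
    also have "\<dots> \<le> 2 * ((q + 1) * card U)" using card_fnorm_vimage_le[of q U] by simp
    finally have "2 * card (\<Omega> \<inter> ?Y) \<le> 4 * ((q + 1) * card U)" by simp
    also obtain l where "q = 4 * (card U + 2) + l" using small le_Suc_ex by blast
    then have "4 * ((q + 1) * card U) \<le> q\<^sup>2" by (simp add: power2_eq_square algebra_simps)
    also have "\<dots> < card \<Omega>" using card_regular_hyperoval_AG_gt[OF hyp] assms(3) by simp
    finally show ?thesis .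
  qed
  have "is_arc q U ?S"
    unfolding is_arc_def
  proof (intro ballI allI impI, elim conjE)
    fix P Q R l
    assume PQR: "P \<in> ?S" "Q \<in> ?S" "R \<in> ?S" and ne: "P \<noteq> Q" "P \<noteq> R" "Q \<noteq> R"
      and inc: "incid q U P l" "incid q U Q l" "incid q U R l"
    from PQR obtain x y x1 y1 x2 y2 where P: "P = Aff x y" "Q = Aff x1 y1" "R = Aff x2 y2"
      and in\<Omega>: "(x, y) \<in> \<Omega>" "(x1, y1) \<in> \<Omega>" "(x2, y2) \<in> \<Omega>"
      and n: "fnorm q x \<notin> U" "fnorm q x1 \<notin> U" "fnorm q x2 \<notin> U"
      by blast
    show False
    proof (cases l)
      case (Vert c)
      show False
        by (rule regular_hyperoval_AG_no_three_collinear[OF hyp, of 0 1 x y "y1 - y" "y2 - y"])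
           (use P in\<Omega> inc ne Vert in auto)
    next
      case (Sl m k)
      then have y: "y = m * x + k" "y1 = m * x1 + k" "y2 = m * x2 + k"
        using inc n P by (simp_all add: odot_def)
      have "(x + (x1 - x) * 1, y + (x1 - x) * m) \<in> \<Omega>" "(x + (x2 - x) * 1, y + (x2 - x) * m) \<in> \<Omega>"
        using in\<Omega> y by (simp_all add: algebra_simps)
      then show False
        using regular_hyperoval_AG_no_three_collinear[OF hyp _ in\<Omega>(1), of 1 m "x1 - x" "x2 - x"] ne P y
        by auto
    next
      case LInf
      then show False using inc P by simp
    qed
  qed
  moreover have "\<not> is_arc q U (insert P ?S)" if P: "P \<notin> ?S" for P
  proof -
    have ext: "\<not> is_arc q U (insert P ?S)"
      if "(x, y) \<in> \<Omega>" "(x', y') \<in> \<Omega>" "(x, y) \<noteq> (x', y')" "fnorm q x \<notin> U" "fnorm q x' \<notin> U"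
        "incid q U (Aff x y) l" "incid q U (Aff x' y') l" "incid q U P l" for x y x' y' l
    proof
      have S: "Aff x y \<in> insert P ?S" "Aff x' y' \<in> insert P ?S" "P \<in> insert P ?S" using that by auto
      have ne: "Aff x y \<noteq> Aff x' y'" "Aff x y \<noteq> P" "Aff x' y' \<noteq> P" using that P by auto
      assume "is_arc q U (insert P ?S)"
      then show False unfolding is_arc_def using S ne that(6-8) by meson
    qed
    show ?thesis
    proof (cases P)
      case (InfS m)
      obtain x y t where xyt: "t \<noteq> 0" "(x, y) \<in> \<Omega> - ?Y" "(x + t * 1, y + t * m) \<in> \<Omega> - ?Y"
        using regular_hyperoval_AG_two_on_parallel_line[OF hyp _ _ few, of "\<lambda>_ _. 1" "\<lambda>_ _. m"] by auto
      show ?thesis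
        by (rule ext[of x y "x + t" "y + t * m" "Sl m (y - m * x)"])
           (use xyt InfS in \<open>auto simp: odot_def algebra_simps\<close>)
    next
      case InfV
      obtain x y t where xyt: "t \<noteq> 0" "(x, y) \<in> \<Omega> - ?Y" "(x + t * 0, y + t * 1) \<in> \<Omega> - ?Y"
        using regular_hyperoval_AG_two_on_parallel_line[OF hyp _ _ few, of "\<lambda>_ _. 0" "\<lambda>_ _. 1"] by auto
      show ?thesis
        by (rule ext[of x y x "y + t" "Vert x"]) (use xyt InfV in auto)
    next
      case (Aff x0 y0)
      show ?thesis
      proof (cases "fnorm q x0 \<in> U")
        case False
        then have not\<Omega>: "(x0, y0) \<notin> \<Omega>" using P Aff by auto
        \<comment> \<open>Radial directions from \<open>P\<close> are nonzero because
          \<open>P\<close> is off \<Omega>; moving by \<open>t\<close> scales them by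
          \<open>1 + t\<close>.\<close>
        have "\<exists>x y t. t \<noteq> 0 \<and> (x, y) \<in> \<Omega> - ?Y \<and> (x + t * (x - x0), y + t * (y - y0)) \<in> \<Omega> - ?Y"
        proof (rule regular_hyperoval_AG_two_on_parallel_line[OF hyp _ _ few])
          show "\<exists>s. x + t * (x - x0) - x0 = s * (x - x0) \<and> y + t * (y - y0) - y0 = s * (y - y0)"
            for x y t by (rule exI[of _ "1 + t"]) (simp add: algebra_simps)
        qed (use not\<Omega> in auto)
        then obtain x y t where xyt: "t \<noteq> 0" "(x, y) \<in> \<Omega> - ?Y"
          "(x + t * (x - x0), y + t * (y - y0)) \<in> \<Omega> - ?Y" by blast
        show ?thesis
        proof (cases "x = x0")
          case True
          then show ?thesis
            by (intro ext[of x y x "y + t * (y - y0)" "Vert x"]) (use xyt Aff not\<Omega> in auto)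
        next
          case ne: False
          define m where "m = (y - y0) / (x - x0)"
          have y: "y = y0 + m * (x - x0)" using ne by (simp add: m_def)
          show ?thesis
            by (rule ext[of x y "x + t * (x - x0)" "y + t * (y - y0)" "Sl m (y0 - m * x0)"])
               (use xyt Aff False ne in \<open>auto simp: odot_def y algebra_simps\<close>)
        qed
      next
        case True
        then have x0: "x0 \<noteq> 0" using assms(4) by (auto simp: fnorm_def)
        define N where "N = fnorm q x0"
        have N0: "N \<noteq> 0" using x0 by (simp add: N_def fnorm_def)
        have norm: "fnorm q (x0 * x) = N * fnorm q x" for x
          by (simp add: N_def fnorm_def power_mult_distrib)
        \<comment> \<open>In coordinates where \<open>P\<close> is \<open>(1, 0)\<close> all norms
          are divided by \<open>N\<close>, so \<open>U\<close> becomes \<open>?V\<close>, and the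
          norm of \<open>P\<close> becomes 1.\<close>
        let ?V = "{w. N * w \<in> U}"
        have "card ?V = card ((*) N ` ?V)"
          using N0 by (intro card_image[symmetric] inj_onI) simp
        also have "\<dots> \<le> card U" by (rule card_mono) auto
        finally have V: "4 * (card ?V + 2) \<le> q"
          by (intro order_trans[OF _ small] mult_le_mono2 add_right_mono)
        have "1 \<in> ?V" "0 \<notin> ?V" using True assms(4) by (auto simp: N_def)
        from two_on_baer_line[OF two frob_add frob_frob
            regular_hyperoval_AG_affine_pullback[OF hyp x0, of y0] assms(3) this V]
        obtain x y x' y' m where xy: "(x0 * x, x0 * y + y0) \<in> \<Omega>" "(x0 * x', x0 * y' + y0) \<in> \<Omega>"
          "(x, y) \<noteq> (x', y')" "N * fnorm q x \<notin> U" "N * fnorm q x' \<notin> U"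
          "y = m * x + m ^ q" "y' = m * x' + m ^ q" by auto
        show ?thesis
        proof (rule ext[OF xy(1,2)])
          show "(x0 * x, x0 * y + y0) \<noteq> (x0 * x', x0 * y' + y0)" using xy(3) x0 by auto
          show "fnorm q (x0 * x) \<notin> U" "fnorm q (x0 * x') \<notin> U" using xy(4,5) by (simp_all add: norm)
          \<comment> \<open>The intercept is forced by the twisted product \<open>m ^ q * x0\<close>
            at \<open>P\<close>. At points of \<Phi> the product is untwisted, so the normalised
            line is \<open>v = m * u + m ^ q\<close>, up to a sign that characteristic two
            removes.\<close>
          show "incid q U P (Sl m (y0 - m ^ q * x0))" using True Aff by (simp add: odot_def)
          have neg: "y0 - m ^ q * x0 = y0 + m ^ q * x0"
            using uminus_eq_char2[OF two, of "m ^ q * x0"] by (metis diff_conv_add_uminus)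
          have "odot q U m (x0 * x) = m * (x0 * x)" "odot q U m (x0 * x') = m * (x0 * x')"
            using xy(4,5) by (simp_all add: odot_def norm)
          then show "incid q U (Aff (x0 * x) (x0 * y + y0)) (Sl m (y0 - m ^ q * x0))"
            "incid q U (Aff (x0 * x') (x0 * y' + y0)) (Sl m (y0 - m ^ q * x0))"
            unfolding neg xy(6,7) by (simp_all add: algebra_simps)
        qed
      qed
    qed
  qed
  ultimately show ?thesis by (simp add: is_complete_arc_def)
qed

end
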